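(* Let $0<\lambda\le 1$ and let $f(z)=z+\sum_{n=2}^{\infty}a_nz^n$ belong to $\mathcal U(\lambda)$. Then $$|a_n|\le 1+\lambda\sqrt{n-1}\,\sqrt{\sum_{k=0}^{n-2}\lambda^{2k}}\qquad\text{for all } n\ge 2.$$
   Context: $\mathbb D=\{z\in\mathbb C:|z|<1\}$ is the unit disk. $\mathcal A$ is the set of functions $f$ analytic in $\mathbb D$ with $f(0)=0$ and $f'(0)=1$. For $0<\lambda\le 1$, $\mathcal U(\lambda)$ is the set of all $f\in\mathcal A$ satisfying $$\left|\left(\frac{z}{f(z)}\right)^2f'(z)-1\right|<\lambda\quad\text{for all } z\in\mathbb D,$$ where $z/f(z)$ takes the value $1$ at $z=0$ (the condition includes that $f(z)\ne0$ for $z\in\mathbb D\setminus\{0\}$). *)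

theory Defs
  imports "HOL-Complex_Analysis.Complex_Analysis"
begin

abbreviation unit_disk :: "complex set" where
  "unit_disk \<equiv> ball 0 1"

definition class_A :: "(complex \<Rightarrow> complex) set" where
  "class_A = {f. f analytic_on unit_disk \<and> f 0 = 0 \<and> deriv f 0 = 1}"

text \<open>The quotient \<open>z / f z\<close>, with its removable singularity at 0 filled in:
  for \<open>f \<in> class_A\<close> the limit there is 1, whereas HOL has \<open>0 / 0 = 0\<close>.\<close>

definition id_over :: "(complex \<Rightarrow> complex) \<Rightarrow> complex \<Rightarrow> complex" where
  "id_over f z = (if z = 0 then 1 else z / f z)"

text \<open>The nonvanishing of \<open>f\<close> off the origin has to be required explicitly: HOL division
  is total, so it is not implied by \<open>z / f z\<close> being well defined.\<close>

definition class_U :: "real \<Rightarrow> (complex \<Rightarrow> complex) set" where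
  "class_U lam = {f \<in> class_A.
     (\<forall>z \<in> unit_disk - {0}. f z \<noteq> 0) \<and>
     (\<forall>z \<in> unit_disk. cmod ((id_over f z)\<^sup>2 * deriv f z - 1) < lam)}"

end

theory Submission
  imports Defs
begin

text \<open>Write \<open>z / f(z) = 1 + z s(z)\<close>. Then \<open>(z / f(z))\<^sup>2 f'(z) - 1 = - z\<^sup>2 s'(z)\<close>, so the defining
  inequality, with the maximum principle, says that \<open>s\<close> is \<open>\<lambda>\<close>-Lipschitz. The coefficient of \<open>z\<^sup>n\<close> in
  \<open>1 / (1 + z(s(z) + t))\<close> is a polynomial in \<open>t\<close>, and the set \<open>K\<close> of those \<open>t\<close> for which the denominator
  has no zero in the disk is compact and contains 0; hence the modulus of the coefficient is largest
  on the frontier of \<open>K\<close>. For \<open>t\<close> in the frontier the denominator vanishes at some \<open>u\<close> with \<open>|u| = 1\<close>,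
  and the Lipschitz condition yields the factorization
  \<open>1 + z(s(z) + t) = (1 - z/u) (1 - z \<phi>(z))\<close> with \<open>|\<phi>| \<le> \<lambda>\<close>. The coefficients of \<open>1 / (1 - z/u)\<close>
  have modulus 1, the square sums of those of \<open>1 / (1 - z\<phi>)\<close> are dominated by those of
  \<open>1 / (1 - \<lambda>z)\<close>, and the Cauchy--Schwarz inequality gives the bound.\<close>

section \<open>Square means on circles and the coefficient bound for a product\<close>

text \<open>Cauchy's formula for the \<open>k\<close>-th derivative, parametrized: on the circle of
  radius \<open>r\<close> one has 1/c^k = cnj (c^k) / r^(2k), which turns it into an inner product
  with a monomial.\<close>

lemma circle_coeff_has_integral:
  assumes g: "g holomorphic_on unit_disk" "g has_fps_expansion G" and r: "0 < r" "r < 1"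
  shows "((\<lambda>t. g (circlepath 0 r t) * cnj (circlepath 0 r t ^ k)) has_integral
           fps_nth G k * of_real (r ^ (2 * k))) {0..1}"
proof -
  let ?c = "circlepath 0 r"
  have nz: "?c t \<noteq> 0" for t
    using r by (simp add: circlepath)
  have nrm: "cmod (?c t) = r" for t
    using r by (simp add: circlepath norm_mult)
  have "((\<lambda>u. g u / (u - 0) ^ Suc k) has_contour_integral (2 * pi * \<i>) / fact k * (deriv ^^ k) g 0) ?c"
    using r g(1)
    by (intro Cauchy_has_contour_integral_higher_derivative_circlepath)
       (auto intro!: holomorphic_on_imp_continuous_on elim!: holomorphic_on_subset)
  then have "((\<lambda>t. g (?c t) / ?c t ^ Suc k * vector_derivative ?c (at t))
      has_integral (2 * pi * \<i>) / fact k * (deriv ^^ k) g 0) {0..1}"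
    by (simp add: has_contour_integral)
  then have "((\<lambda>t. of_real (r ^ (2 * k)) / (2 * pi * \<i>) *
        (g (?c t) / ?c t ^ Suc k * vector_derivative ?c (at t)))
      has_integral of_real (r ^ (2 * k)) / (2 * pi * \<i>) * ((2 * pi * \<i>) / fact k * (deriv ^^ k) g 0)) {0..1}"
    by (rule has_integral_mult_right)
  moreover have "of_real (r ^ (2 * k)) / (2 * pi * \<i>) * ((2 * pi * \<i>) / fact k * (deriv ^^ k) g 0)
      = fps_nth G k * of_real (r ^ (2 * k))"
    using fps_nth_fps_expansion[OF g(2), of k] by (simp add: field_simps)
  moreover have "of_real (r ^ (2 * k)) / (2 * pi * \<i>) * (g (?c t) / ?c t ^ Suc k * vector_derivative ?c (at t))
      = g (?c t) * cnj (?c t ^ k)" for t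
  proof -
    have vd: "vector_derivative ?c (at t) = 2 * pi * \<i> * ?c t"
      by (simp add: vector_derivative_circlepath) (simp add: circlepath)
    have "?c t * cnj (?c t) = of_real (r ^ 2)"
      by (simp add: complex_norm_square [symmetric] nrm)
    then have "of_real (r ^ (2 * k)) = ?c t ^ k * cnj (?c t ^ k)"
      by (metis complex_cnj_power of_real_power power_mult power_mult_distrib)
    then show ?thesis
      using nz[of t] by (simp add: vd del: complex_cnj_power of_real_power) (simp add: mult_ac)
  qed
  ultimately show ?thesis
    by simp
qed

text \<open>Bessel's inequality for the monomials on a circle: expand the mean of |g - T|^2, which
  is nonnegative, with \<open>T\<close> the Taylor polynomial. If \<open>g\<close> is itself this
  polynomial, it becomes Parseval's identity.\<close>

lemma circle_bessel:
  assumes g: "g holomorphic_on unit_disk" "g has_fps_expansion G" and r: "0 < r" "r < 1"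
  shows "(\<Sum>k<n. (cmod (fps_nth G k))\<^sup>2 * r ^ (2 * k))
           \<le> integral {0..1} (\<lambda>t. (cmod (g (circlepath 0 r t)))\<^sup>2)"
    and "g = (\<lambda>z. \<Sum>k<n. fps_nth G k * z ^ k) \<Longrightarrow>
         integral {0..1} (\<lambda>t. (cmod (g (circlepath 0 r t)))\<^sup>2)
           = (\<Sum>k<n. (cmod (fps_nth G k))\<^sup>2 * r ^ (2 * k))"
proof -
  let ?S = "\<Sum>k<n. (cmod (fps_nth G k))\<^sup>2 * r ^ (2 * k)"
  let ?c = "circlepath 0 r"
  define T where "T z = (\<Sum>k<n. fps_nth G k * z ^ k)" for z
  \<comment> \<open>Only the first \<open>n\<close> coefficients of \<open>h\<close> matter, so the
    same formula serves for \<open>h = g\<close> and for \<open>h = T\<close>.\<close>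
  have inner: "((\<lambda>t. h (?c t) * cnj (T (?c t))) has_integral of_real ?S) {0..1}"
    if h: "h holomorphic_on unit_disk" "h has_fps_expansion H"
      and eq: "\<And>k. k < n \<Longrightarrow> fps_nth H k = fps_nth G k" for h H
  proof -
    have "((\<lambda>t. \<Sum>k<n. cnj (fps_nth G k) * (h (?c t) * cnj (?c t ^ k)))
        has_integral (\<Sum>k<n. cnj (fps_nth G k) * (fps_nth H k * of_real (r ^ (2 * k))))) {0..1}"
      by (intro has_integral_sum has_integral_mult_right circle_coeff_has_integral h r) auto
    moreover have "(\<Sum>k<n. cnj (fps_nth G k) * (fps_nth H k * of_real (r ^ (2 * k)))) = of_real ?S"
      unfolding of_real_sum
      by (intro sum.cong refl) (simp add: eq complex_norm_square del: of_real_power)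
    moreover have "(\<Sum>k<n. cnj (fps_nth G k) * (h (?c t) * cnj (?c t ^ k))) = h (?c t) * cnj (T (?c t))" for t
      by (simp add: T_def sum_distrib_left mult_ac)
    ultimately show ?thesis
      by simp
  qed
  have T: "T holomorphic_on unit_disk" "T has_fps_expansion (\<Sum>k<n. fps_const (fps_nth G k) * fps_X ^ k)"
    unfolding T_def by (auto intro!: holomorphic_intros fps_expansion_intros)
  have Tnth: "fps_nth (\<Sum>k<n. fps_const (fps_nth G k) * fps_X ^ k) j = fps_nth G j" if "j < n" for j
    using that by (simp add: fps_sum_nth fps_X_power_nth if_distrib cong: if_cong)
  have TT: "((\<lambda>t. (cmod (T (?c t)))\<^sup>2) has_integral ?S) {0..1}"
    using has_integral_Re[OF inner[OF T Tnth]] by (simp add: complex_norm_square [symmetric] del: of_real_power)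
  have gT: "((\<lambda>t. 2 * Re (g (?c t) * cnj (T (?c t)))) has_integral 2 * ?S) {0..1}"
    using has_integral_mult_right[OF has_integral_Re[OF inner[OF g]], of 2] by simp
  have cont: "continuous_on {0..1} (\<lambda>t. g (?c t))"
    using r by (intro continuous_on_compose2[OF holomorphic_on_imp_continuous_on[OF g(1)]])
       (auto simp: circlepath norm_mult intro!: continuous_intros)
  have gg: "(\<lambda>t. (cmod (g (?c t)))\<^sup>2) integrable_on {0..1}"
    by (intro integrable_continuous_interval continuous_intros cont)
  have "((\<lambda>t. (cmod (g (?c t)))\<^sup>2 - 2 * Re (g (?c t) * cnj (T (?c t))) + (cmod (T (?c t)))\<^sup>2) has_integral
      integral {0..1} (\<lambda>t. (cmod (g (?c t)))\<^sup>2) - 2 * ?S + ?S) {0..1}"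
    by (intro has_integral_add has_integral_diff integrable_integral gg gT TT)
  moreover have "(cmod a)\<^sup>2 - 2 * Re (a * cnj b) + (cmod b)\<^sup>2 \<ge> 0" for a b
    using zero_le_power2[of "cmod (a - b)"]
    unfolding cmod_power2 by (simp add: power2_eq_square algebra_simps)
  ultimately have "0 \<le> integral {0..1} (\<lambda>t. (cmod (g (?c t)))\<^sup>2) - 2 * ?S + ?S"
    by (rule has_integral_nonneg)
  then show "?S \<le> integral {0..1} (\<lambda>t. (cmod (g (?c t)))\<^sup>2)"
    by simp
  show "integral {0..1} (\<lambda>t. (cmod (g (?c t)))\<^sup>2) = ?S" if "g = (\<lambda>z. \<Sum>k<n. fps_nth G k * z ^ k)"
    using integral_unique[OF TT] that by (simp add: T_def)
qed

text \<open>The first \<open>n\<close> coefficients of \<open>\<Phi> * H\<close> depend only on the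
  first \<open>n\<close> of \<open>H\<close>, so \<open>H\<close> may be replaced by its truncation
  \<open>q\<close>. Bessel for \<open>\<phi> * q\<close>, the pointwise bound on
  \<open>\<phi>\<close> and Parseval for \<open>q\<close> give the estimate on each circle inside
  the disk.\<close>

lemma bounded_multiplier_contracts:
  assumes \<phi>: "\<phi> holomorphic_on unit_disk" "\<phi> has_fps_expansion \<Phi>"
    and bound: "\<And>z. z \<in> unit_disk \<Longrightarrow> cmod (\<phi> z) \<le> \<mu>"
  shows "(\<Sum>k<n. (cmod (fps_nth (\<Phi> * H) k))\<^sup>2) \<le> \<mu>\<^sup>2 * (\<Sum>k<n. (cmod (fps_nth H k))\<^sup>2)"
proof -
  define Q where "Q = (\<Sum>k<n. fps_const (fps_nth H k) * fps_X ^ k)"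
  define q where "q z = (\<Sum>k<n. fps_nth H k * z ^ k)" for z
  have q: "q holomorphic_on unit_disk" "q has_fps_expansion Q"
    unfolding q_def Q_def by (auto intro!: holomorphic_intros fps_expansion_intros)
  have Qnth: "fps_nth Q j = fps_nth H j" if "j < n" for j
    using that by (simp add: Q_def fps_sum_nth fps_X_power_nth if_distrib cong: if_cong)
  have qQ: "q = (\<lambda>z. \<Sum>k<n. fps_nth Q k * z ^ k)"
    by (simp add: fun_eq_iff q_def Qnth)
  have \<phi>q: "(\<lambda>z. \<phi> z * q z) holomorphic_on unit_disk" "(\<lambda>z. \<phi> z * q z) has_fps_expansion \<Phi> * Q"
    using \<phi> q by (auto intro!: holomorphic_intros fps_expansion_intros)
  have nth: "fps_nth (\<Phi> * Q) k = fps_nth (\<Phi> * H) k" if "k < n" for k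
    using that by (auto simp: fps_mult_nth Qnth intro!: sum.cong)
  have est: "(\<Sum>k<n. (cmod (fps_nth (\<Phi> * H) k))\<^sup>2 * r ^ (2 * k))
      \<le> \<mu>\<^sup>2 * (\<Sum>k<n. (cmod (fps_nth H k))\<^sup>2 * r ^ (2 * k))" if r: "0 < r" "r < 1" for r :: real
  proof -
    let ?c = "circlepath 0 r"
    have c: "?c t \<in> unit_disk" for t
      using r by (simp add: circlepath norm_mult)
    have cont: "continuous_on {0..1} (\<lambda>t. h (?c t))" if "h holomorphic_on unit_disk" for h
      using c by (intro continuous_on_compose2[OF holomorphic_on_imp_continuous_on[OF that]])
         (auto simp: circlepath intro!: continuous_intros)
    have "(\<Sum>k<n. (cmod (fps_nth (\<Phi> * H) k))\<^sup>2 * r ^ (2 * k))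
        = (\<Sum>k<n. (cmod (fps_nth (\<Phi> * Q) k))\<^sup>2 * r ^ (2 * k))"
      by (simp add: nth)
    also have "\<dots> \<le> integral {0..1} (\<lambda>t. (cmod (\<phi> (?c t) * q (?c t)))\<^sup>2)"
      by (rule circle_bessel(1)[OF \<phi>q r])
    also have "\<dots> \<le> integral {0..1} (\<lambda>t. \<mu>\<^sup>2 * (cmod (q (?c t)))\<^sup>2)"
    proof (intro integral_le integrable_continuous_interval continuous_intros cont \<phi> q)
      fix t
      show "(cmod (\<phi> (?c t) * q (?c t)))\<^sup>2 \<le> \<mu>\<^sup>2 * (cmod (q (?c t)))\<^sup>2"
        unfolding norm_mult power_mult_distrib
        by (intro mult_right_mono power_mono bound c) auto
    qed
    also have "\<dots> = \<mu>\<^sup>2 * integral {0..1} (\<lambda>t. (cmod (q (?c t)))\<^sup>2)"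
      by simp
    also have "\<dots> = \<mu>\<^sup>2 * (\<Sum>k<n. (cmod (fps_nth H k))\<^sup>2 * r ^ (2 * k))"
      using circle_bessel(2)[OF q r qQ] by (simp add: Qnth)
    finally show ?thesis .
  qed
  \<comment> \<open>Both sides are finite sums, so the weights r^(2k) disappear as \<open>r\<close>
    tends to 1.\<close>
  have "((\<lambda>r. \<Sum>k<n. (cmod (fps_nth (\<Phi> * H) k))\<^sup>2 * r ^ (2 * k))
      \<longlongrightarrow> (\<Sum>k<n. (cmod (fps_nth (\<Phi> * H) k))\<^sup>2 * 1 ^ (2 * k))) (at_left 1)"
    by (intro tendsto_intros)
  moreover have "((\<lambda>r. \<mu>\<^sup>2 * (\<Sum>k<n. (cmod (fps_nth H k))\<^sup>2 * r ^ (2 * k)))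
      \<longlongrightarrow> \<mu>\<^sup>2 * (\<Sum>k<n. (cmod (fps_nth H k))\<^sup>2 * 1 ^ (2 * k))) (at_left 1)"
    by (intro tendsto_intros)
  moreover have "\<forall>\<^sub>F r in at_left 1. (\<Sum>k<n. (cmod (fps_nth (\<Phi> * H) k))\<^sup>2 * r ^ (2 * k))
      \<le> \<mu>\<^sup>2 * (\<Sum>k<n. (cmod (fps_nth H k))\<^sup>2 * r ^ (2 * k))"
    using eventually_at_left_real[of 0 1] by (auto intro: est elim!: eventually_mono)
  ultimately show ?thesis
    using tendsto_le[OF trivial_limit_at_left_real] by fastforce
qed

text \<open>Comparing coefficients in \<open>H = 1 + z\<phi>H\<close>, where \<open>H = 1 / (1 - z\<phi>)\<close>, turns the contraction
  property into a recursive bound for the square sums of \<open>H\<close>.\<close>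

lemma coeff_bound_product:
  assumes \<phi>: "\<phi> holomorphic_on unit_disk" "\<phi> has_fps_expansion \<Phi>"
    and bound: "\<And>z. z \<in> unit_disk \<Longrightarrow> cmod (\<phi> z) \<le> \<mu>" and v: "cmod v \<le> 1"
    and C: "C * ((1 - fps_const v * fps_X) * (1 - fps_X * \<Phi>)) = 1"
  shows "cmod (fps_nth C n) \<le> 1 + \<mu> * sqrt n * sqrt (\<Sum>k<n. \<mu> ^ (2 * k))"
proof -
  have \<mu>: "0 \<le> \<mu>"
    by (rule order_trans[OF norm_ge_zero bound[of 0]]) simp
  \<comment> \<open>Since \<open>C\<close> inverts the whole product, this is the inverse of the
    second factor alone.\<close>
  define H where "H = C * (1 - fps_const v * fps_X)"
  have "H * (1 - fps_X * \<Phi>) = 1"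
    using C by (simp add: H_def mult_ac)
  then have H: "H = 1 + fps_X * (\<Phi> * H)"
    by (simp add: algebra_simps)
  have H0: "fps_nth H 0 = 1"
    by (subst H) simp
  have HSuc: "fps_nth H (Suc k) = fps_nth (\<Phi> * H) k" for k
    by (subst H) simp
  \<comment> \<open>The constant coefficient 1 is left out. The bound is \<mu>^2 + ... + \<mu>^(2m),
    the corresponding sum for 1 / (1 - \<mu> z).\<close>
  have sq: "(\<Sum>k<m. (cmod (fps_nth H (Suc k)))\<^sup>2) \<le> \<mu>\<^sup>2 * (\<Sum>k<m. \<mu> ^ (2 * k))" for m
  proof (induction m)
    case (Suc m)
    have "(\<Sum>k<Suc m. (cmod (fps_nth H (Suc k)))\<^sup>2) \<le> \<mu>\<^sup>2 * (\<Sum>k<Suc m. (cmod (fps_nth H k))\<^sup>2)"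
      unfolding HSuc by (rule bounded_multiplier_contracts[OF \<phi> bound])
    also have "\<dots> = \<mu>\<^sup>2 * (1 + (\<Sum>k<m. (cmod (fps_nth H (Suc k)))\<^sup>2))"
      by (subst sum.lessThan_Suc_shift) (simp add: H0)
    also have "\<dots> \<le> \<mu>\<^sup>2 * (1 + \<mu>\<^sup>2 * (\<Sum>k<m. \<mu> ^ (2 * k)))"
      using Suc.IH by (intro mult_left_mono add_left_mono) auto
    also have "\<dots> = \<mu>\<^sup>2 * (\<Sum>k<Suc m. \<mu> ^ (2 * k))"
      by (subst sum.lessThan_Suc_shift)
         (simp add: sum_distrib_left power2_eq_square mult_ac)
    finally show ?case .
  qed simp
  \<comment> \<open>The geometric series for the first factor: its coefficients have modulus at most
    1, so those of \<open>C = H * V\<close> are bounded by partial sums of the moduli of those of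
    \<open>H\<close>.\<close>
  define V where "V = Abs_fps (\<lambda>k. v ^ k)"
  have V: "V * (1 - fps_const v * fps_X) = 1"
  proof -
    have "V = 1 + fps_const v * fps_X * V"
      by (rule fps_ext) (auto simp: V_def mult.assoc fps_X_mult_nth gr0_conv_Suc power_Suc[symmetric] simp del: power_Suc split: if_splits)
    then show ?thesis
      by (simp add: algebra_simps)
  qed
  have "C = C * (V * (1 - fps_const v * fps_X))"
    by (simp add: V)
  also have "\<dots> = H * V"
    by (simp add: H_def mult_ac)
  finally have "fps_nth C n = (\<Sum>k=0..n. fps_nth H k * v ^ (n - k))"
    by (simp add: fps_mult_nth V_def)
  then have "cmod (fps_nth C n) \<le> (\<Sum>k=0..n. cmod (fps_nth H k))"
    using v by (auto simp: norm_mult norm_power power_le_one intro!: sum_norm_le mult_left_le)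
  also have "\<dots> = 1 + (\<Sum>k<n. cmod (fps_nth H (Suc k)))"
    by (simp add: H0 atLeast0AtMost lessThan_Suc_atMost[symmetric] sum.lessThan_Suc_shift del: sum.lessThan_Suc)
  also have "(\<Sum>k<n. cmod (fps_nth H (Suc k))) \<le> sqrt n * sqrt (\<mu>\<^sup>2 * (\<Sum>k<n. \<mu> ^ (2 * k)))"
  proof -
    have "(\<Sum>k<n. \<bar>1\<bar> * \<bar>cmod (fps_nth H (Suc k))\<bar>)
        \<le> L2_set (\<lambda>k. 1) {..<n} * L2_set (\<lambda>k. cmod (fps_nth H (Suc k))) {..<n}"
      by (rule L2_set_mult_ineq)
    also have "\<dots> \<le> sqrt n * sqrt (\<mu>\<^sup>2 * (\<Sum>k<n. \<mu> ^ (2 * k)))"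
      unfolding L2_set_def using sq[of n] by (auto intro!: mult_mono sum_nonneg)
    finally show ?thesis
      by simp
  qed
  finally show ?thesis
    using \<mu> by (simp add: real_sqrt_mult mult_ac)
qed


section \<open>The maximum principle and zero-free parameters\<close>

text \<open>The identity C = 1 - X C (S + t) expresses each coefficient of the inverse through
  earlier ones and \<open>t\<close>; by induction all of them are polynomials in
  \<open>t\<close>.\<close>

lemma holomorphic_fps_nth_inverse:
  fixes S :: "complex fps"
  shows "(\<lambda>t. fps_nth (inverse (1 + fps_X * (S + fps_const t))) n) holomorphic_on A"
proof (induction n rule: less_induct)
  case (less n)
  define C where "C t = inverse (1 + fps_X * (S + fps_const t))" for t
  have "C t * (1 + fps_X * (S + fps_const t)) = 1" for t
    unfolding C_def by (intro inverse_mult_eq_1) simp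
  then have C: "C t = 1 - fps_X * (C t * (S + fps_const t))" for t
    by (simp add: algebra_simps)
  show ?case
  proof (cases n)
    case 0
    then show ?thesis by simp
  next
    case (Suc m)
    have "fps_nth (C t) (Suc m) = - (\<Sum>i=0..m. fps_nth (C t) i * (fps_nth S (m - i) + (if m - i = 0 then t else 0)))" for t
      by (subst C, simp, simp add: fps_mult_nth)
    moreover have if_holomorphic: "(\<lambda>t. if b then t else 0) holomorphic_on A" for b
      by (cases b) auto
    moreover have "(\<lambda>t. fps_nth (C t) i) holomorphic_on A" if "i \<le> m" for i
      using less.IH[of i] that by (simp add: Suc C_def)
    then have "(\<lambda>t. - (\<Sum>i=0..m. fps_nth (C t) i * (fps_nth S (m - i) + (if m - i = 0 then t else 0)))) holomorphic_on A"
      by (intro holomorphic_intros) (auto intro!: holomorphic_intros if_holomorphic)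
    ultimately show ?thesis
      by (simp add: Suc C_def)
  qed
qed

text \<open>A Schwarz-type argument: on |w| = r the hypothesis gives |h w| <= \<mu> / r^2, the
  maximum principle carries this inwards, and \<open>r\<close> tends to 1. It will strip the factor
  z^2 from z^2 s'(z).\<close>

lemma norm_le_of_norm_square_mult_le:
  assumes h: "h holomorphic_on unit_disk" and le: "\<And>z. z \<in> unit_disk \<Longrightarrow> cmod (z\<^sup>2 * h z) \<le> \<mu>"
    and z: "z \<in> unit_disk"
  shows "cmod (h z) \<le> \<mu>"
proof -
  have "cmod (h z) \<le> \<mu> / r\<^sup>2" if r: "cmod z < r" "r < 1" for r
  proof (rule maximum_modulus_frontier[of h "ball 0 r" "\<mu> / r\<^sup>2"])
    have r0: "0 < r"
      using r(1) norm_ge_zero[of z] by linarith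
    show "h holomorphic_on interior (ball 0 r)"
      using r by (auto intro: holomorphic_on_subset[OF h])
    show "continuous_on (closure (ball 0 r)) h"
      using r r0 by (auto intro!: continuous_on_subset[OF holomorphic_on_imp_continuous_on[OF h]])
    show "cmod (h w) \<le> \<mu> / r\<^sup>2" if "w \<in> frontier (ball 0 r)" for w
    proof -
      have w: "cmod w = r"
        using that r0 by simp
      then have "r\<^sup>2 * cmod (h w) \<le> \<mu>"
        using le[of w] r by (simp add: norm_mult norm_power)
      then show ?thesis
        using r0 by (simp add: field_simps)
    qed
  qed (use r in auto)
  then have "\<forall>\<^sub>F r in at_left 1. cmod (h z) \<le> \<mu> / r\<^sup>2"
    using eventually_at_left_real[of "cmod z" 1] z by (auto elim!: eventually_mono)
  moreover have "((\<lambda>r. \<mu> / r\<^sup>2) \<longlongrightarrow> \<mu> / 1\<^sup>2) (at_left (1::real))"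
    by (intro tendsto_intros) auto
  ultimately show ?thesis
    using tendsto_lowerbound[of _ _ "at_left (1::real)"] by fastforce
qed

text \<open>For \<open>t \<noteq> 0\<close> the function \<open>1 + z(s + t)\<close> has a zero in the disk iff \<open>-1/t\<close> is a value of
  \<open>z / (1 + z s)\<close>, so the open mapping theorem applies.\<close>

lemma compact_zero_free_parameters:
  assumes s: "s holomorphic_on unit_disk" and nz: "\<And>z. z \<in> unit_disk \<Longrightarrow> 1 + z * s z \<noteq> 0"
  shows "compact {t. \<forall>z\<in>unit_disk. 1 + z * (s z + t) \<noteq> 0}" (is "compact ?K")
proof -
  define f where "f z = z / (1 + z * s z)" for z
  have hol: "f holomorphic_on unit_disk"
    unfolding f_def using s nz by (intro holomorphic_intros) auto
  have "(0::complex) \<in> unit_disk" "(1 / 2::complex) \<in> unit_disk"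
    by simp_all
  moreover have "f 0 \<noteq> f (1 / 2)"
    using nz[of "1 / 2"] by (auto simp: f_def add_eq_0_iff)
  ultimately have "\<not> f constant_on unit_disk"
    unfolding constant_on_def by metis
  then have op: "open (f ` unit_disk)"
    by (intro open_mapping_thm[OF hol]) auto
  have compl: "- ?K = (- {0}) \<inter> (\<lambda>t. - 1 / t) -` (f ` unit_disk)"
  proof -
    have "1 + z * (s z + t) = 0 \<longleftrightarrow> t \<noteq> 0 \<and> - 1 / t = f z" if "z \<in> unit_disk" for z t
    proof (cases "t = 0")
      case False
      have "- 1 / t = f z \<longleftrightarrow> - 1 * (1 + z * s z) = z * t"
        unfolding f_def by (intro frac_eq_eq False nz that)
      also have "\<dots> \<longleftrightarrow> 1 + z * (s z + t) = 0"
        by algebra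
      finally show ?thesis
        using False by simp
    qed (use nz[OF that] in simp)
    then show ?thesis
      by fastforce
  qed
  have "open (- ?K)"
    unfolding compl using op by (intro continuous_open_preimage continuous_intros) auto
  then have "closed ?K"
    by (simp add: closed_def)
  \<comment> \<open>The open image of \<open>f\<close> contains \<open>f 0 = 0\<close>, hence a ball
    of radius \<open>d\<close>; if |t| > 1/d, then -1/t lies in that ball and \<open>t\<close> is
    excluded.\<close>
  moreover have "bounded ?K"
  proof -
    have "0 \<in> f ` unit_disk"
      by (auto simp: f_def intro!: image_eqI[of _ _ 0])
    then obtain d where d: "0 < d" "ball 0 d \<subseteq> f ` unit_disk"
      using op by (auto simp: open_contains_ball)
    have "cmod t \<le> 1 / d" if "t \<in> ?K" for t
    proof (rule ccontr)
      assume "\<not> ?thesis"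
      then have t: "1 / d < cmod t"
        by simp
      then have "t \<noteq> 0"
        using d(1) by (auto simp: field_simps)
      moreover from this t d(1) have "- 1 / t \<in> ball 0 d"
        by (simp add: norm_divide field_simps)
      ultimately have "t \<in> - ?K"
        unfolding compl using d(2) by auto
      then show False
        using that by blast
    qed
    then show ?thesis
      by (auto simp: bounded_iff)
  qed
  ultimately show ?thesis
    by (simp add: compact_eq_bounded_closed)
qed

text \<open>Approach \<open>t\<close> by parameters outside the set, each with a zero z_n in the
  disk, and pass to a limit \<open>u\<close> of these zeros. It cannot lie inside the disk, where
  \<open>tK\<close> forbids a zero. The number \<open>\<sigma>\<close> acts as the boundary value of
  \<open>s\<close> at \<open>u\<close>.\<close>

lemma zero_free_parameters_frontier:
  assumes s: "s holomorphic_on unit_disk"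
    and lip: "\<And>z w. z \<in> unit_disk \<Longrightarrow> w \<in> unit_disk \<Longrightarrow> cmod (s z - s w) \<le> \<mu> * cmod (z - w)"
    and t: "t \<in> frontier {t. \<forall>z\<in>unit_disk. 1 + z * (s z + t) \<noteq> 0}" (is "t \<in> frontier ?K")
    and tK: "\<And>z. z \<in> unit_disk \<Longrightarrow> 1 + z * (s z + t) \<noteq> 0"
  obtains u \<sigma> where "cmod u = 1" "1 + u * (\<sigma> + t) = 0"
    "\<And>z. z \<in> unit_disk \<Longrightarrow> cmod (s z - \<sigma>) \<le> \<mu> * cmod (z - u)"
proof -
  have "t \<in> closure (- ?K)"
    using t by (simp add: frontier_closures)
  then obtain x where x: "\<And>n. x n \<in> - ?K" "x \<longlonglongrightarrow> t"
    unfolding closure_sequential by blast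
  then have "\<forall>n. \<exists>z\<in>unit_disk. 1 + z * (s z + x n) = 0"
    by blast
  then obtain z where z: "\<And>n. z n \<in> unit_disk" "\<And>n. 1 + z n * (s (z n) + x n) = 0"
    by metis
  have \<mu>: "0 \<le> \<mu>"
    using order_trans[OF norm_ge_zero lip[of 0 "1 / 2"]] by (simp add: zero_le_mult_iff)
  have bd: "s (z n) \<in> cball (s 0) \<mu>" for n
  proof -
    have "cmod (s 0 - s (z n)) \<le> \<mu> * cmod (0 - z n)"
      by (intro lip z) auto
    also have "\<dots> \<le> \<mu> * 1"
      using z(1)[of n] by (intro mult_left_mono \<mu>) simp
    finally show ?thesis
      by (simp add: dist_norm)
  qed
  \<comment> \<open>Compactness is applied to the pairs (z_n, s(z_n)), so that the values of
    \<open>s\<close> converge along the same subsequence even when \<open>u\<close> is on the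
    circle.\<close>
  have "compact (cball (0::complex) 1 \<times> cball (s 0) \<mu>)"
    by (intro compact_Times compact_cball)
  moreover have "\<forall>n. (z n, s (z n)) \<in> cball 0 1 \<times> cball (s 0) \<mu>"
    using z(1) bd by (auto simp: less_imp_le)
  ultimately obtain l r where r: "l \<in> cball (0::complex) 1 \<times> cball (s 0) \<mu>" "strict_mono (r :: nat \<Rightarrow> nat)"
      "((\<lambda>n. (z n, s (z n))) \<circ> r) \<longlonglongrightarrow> l"
    unfolding compact_def by meson
  define u \<sigma> where "u = fst l" and "\<sigma> = snd l"
  have zu: "(\<lambda>n. z (r n)) \<longlonglongrightarrow> u" and s\<sigma>: "(\<lambda>n. s (z (r n))) \<longlonglongrightarrow> \<sigma>"
    using tendsto_fst[OF r(3)] tendsto_snd[OF r(3)] by (simp_all add: u_def \<sigma>_def o_def)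
  have xt: "(\<lambda>n. x (r n)) \<longlonglongrightarrow> t"
    using LIMSEQ_subseq_LIMSEQ[OF x(2) r(2)] by (simp add: o_def)
  have "(\<lambda>n. 1 + z (r n) * (s (z (r n)) + x (r n))) \<longlonglongrightarrow> 1 + u * (\<sigma> + t)"
    by (intro tendsto_intros zu s\<sigma> xt)
  then have eq: "1 + u * (\<sigma> + t) = 0"
    using z(2) by (simp add: LIMSEQ_const_iff)
  have "cmod u = 1"
  proof (rule ccontr)
    assume "cmod u \<noteq> 1"
    then have u: "u \<in> unit_disk"
      using r(1) by (auto simp: u_def)
    have "isCont s u"
      using holomorphic_on_imp_continuous_on[OF s] u by (simp add: continuous_on_eq_continuous_at)
    then have "(\<lambda>n. s (z (r n))) \<longlonglongrightarrow> s u"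
      using zu by (rule isCont_tendsto_compose)
    then have "\<sigma> = s u"
      using s\<sigma> LIMSEQ_unique by blast
    then show False
      using tK[OF u] eq by simp
  qed
  moreover have "cmod (s w - \<sigma>) \<le> \<mu> * cmod (w - u)" if "w \<in> unit_disk" for w
  proof (rule LIMSEQ_le)
    show "(\<lambda>n. cmod (s w - s (z (r n)))) \<longlonglongrightarrow> cmod (s w - \<sigma>)"
      by (intro tendsto_intros s\<sigma>)
    show "(\<lambda>n. \<mu> * cmod (w - z (r n))) \<longlonglongrightarrow> \<mu> * cmod (w - u)"
      by (intro tendsto_intros zu)
  qed (use lip z that in blast)
  ultimately show ?thesis
    using eq that by blast
qed

section \<open>The coefficient bound for Lipschitz \<open>s\<close>\<close>

lemma coeff_bound_lipschitz:
  assumes s: "s holomorphic_on unit_disk" "s has_fps_expansion S"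
    and lip: "\<And>z w. z \<in> unit_disk \<Longrightarrow> w \<in> unit_disk \<Longrightarrow> cmod (s z - s w) \<le> \<mu> * cmod (z - w)"
    and nz: "\<And>z. z \<in> unit_disk \<Longrightarrow> 1 + z * s z \<noteq> 0"
  shows "cmod (fps_nth (inverse (1 + fps_X * S)) n) \<le> 1 + \<mu> * sqrt n * sqrt (\<Sum>k<n. \<mu> ^ (2 * k))"
proof -
  define K where "K = {t. \<forall>z\<in>unit_disk. 1 + z * (s z + t) \<noteq> 0}"
  define P where "P t = fps_nth (inverse (1 + fps_X * (S + fps_const t))) n" for t
  have K: "compact K"
    unfolding K_def by (rule compact_zero_free_parameters[OF s(1) nz])
  have hol: "P holomorphic_on A" for A
    unfolding P_def by (rule holomorphic_fps_nth_inverse)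
  have frontier: "cmod (P t) \<le> 1 + \<mu> * sqrt n * sqrt (\<Sum>k<n. \<mu> ^ (2 * k))" if t: "t \<in> frontier K" for t
  proof -
    have "t \<in> K"
      using t K frontier_subset_closed compact_imp_closed by blast
    then obtain u \<sigma> where u: "cmod u = 1" "1 + u * (\<sigma> + t) = 0"
      and \<sigma>: "\<And>z. z \<in> unit_disk \<Longrightarrow> cmod (s z - \<sigma>) \<le> \<mu> * cmod (z - u)"
      using zero_free_parameters_frontier[OF s(1) lip, of t] t unfolding K_def by blast
    define v where "v = inverse u"
    have v: "cmod v = 1" "v * u = 1"
      using u(1) by (auto simp: v_def norm_inverse intro!: left_inverse)
    have tv: "\<sigma> + t = - v"
      using u(2) v(2) by (metis add_eq_0_iff mult.left_commute mult_minus_right mult.right_neutral)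
    have vz: "1 - v * z \<noteq> 0" if "z \<in> unit_disk" for z
    proof
      assume "1 - v * z = 0"
      then have "cmod (v * z) = 1"
        by simp
      then show False
        using v(1) that by (simp add: norm_mult)
    qed
    \<comment> \<open>Up to the unimodular factor \<open>u\<close>, this is the difference quotient
      of \<open>s\<close> at the boundary point \<open>u\<close>, because 1 - v z = (u - z) / u. The
      Lipschitz bound therefore bounds it by \<open>\<mu>\<close>.\<close>
    define \<phi> where "\<phi> z = (\<sigma> - s z) / (1 - v * z)" for z
    define \<Phi> where "\<Phi> = fps_expansion \<phi> 0"
    have \<phi>: "\<phi> holomorphic_on unit_disk"
      unfolding \<phi>_def using vz s(1) by (intro holomorphic_intros) auto
    then have \<Phi>: "\<phi> has_fps_expansion \<Phi>"
      unfolding \<Phi>_def by (intro has_fps_expansion_fps_expansion[of unit_disk]) auto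
    have bound: "cmod (\<phi> z) \<le> \<mu>" if z: "z \<in> unit_disk" for z
    proof -
      have "u * (1 - v * z) = u - z"
        using v(2) by (simp add: algebra_simps)
      then have "cmod (u - z) = cmod (1 - v * z)"
        using u(1) by (metis mult_1 norm_mult)
      then have "cmod (\<sigma> - s z) \<le> \<mu> * cmod (1 - v * z)"
        using \<sigma>[OF z] by (simp add: norm_minus_commute)
      then show ?thesis
        using vz[OF z] by (simp add: \<phi>_def norm_divide pos_divide_le_eq)
    qed
    \<comment> \<open>By \<open>tv\<close>, the term - v z equals z (\<sigma> + t), and \<sigma>
      then cancels.\<close>
    have "(1 - v * z) * (1 - z * \<phi> z) = 1 + z * (s z + t)" if z: "z \<in> unit_disk" for z
    proof -
      have "(1 - v * z) * \<phi> z = \<sigma> - s z"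
        using vz[OF z] by (simp add: \<phi>_def)
      then have "(1 - v * z) * (1 - z * \<phi> z) = 1 - v * z - z * (\<sigma> - s z)"
        by algebra
      also have "\<dots> = 1 + z * (s z + t)"
        using tv by algebra
      finally show ?thesis .
    qed
    then have ev: "\<forall>\<^sub>F z in nhds 0. (1 - v * z) * (1 - z * \<phi> z) = 1 + z * (s z + t)"
      by (intro eventually_nhds_in_open[of unit_disk 0, THEN eventually_mono]) auto
    have "(\<lambda>z. (1 - v * z) * (1 - z * \<phi> z)) has_fps_expansion
        (1 - fps_const v * fps_X) * (1 - fps_X * \<Phi>)"
      by (intro fps_expansion_intros \<Phi>)
    then have "(\<lambda>z. 1 + z * (s z + t)) has_fps_expansion
        (1 - fps_const v * fps_X) * (1 - fps_X * \<Phi>)"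
      using has_fps_expansion_cong[OF ev refl] by blast
    moreover have "(\<lambda>z. 1 + z * (s z + t)) has_fps_expansion 1 + fps_X * (S + fps_const t)"
      by (intro fps_expansion_intros s)
    ultimately have "1 + fps_X * (S + fps_const t) = (1 - fps_const v * fps_X) * (1 - fps_X * \<Phi>)"
      using fps_expansion_eqI by metis
    moreover have "inverse (1 + fps_X * (S + fps_const t)) * (1 + fps_X * (S + fps_const t)) = 1"
      by (intro inverse_mult_eq_1) simp
    ultimately show ?thesis
      unfolding P_def using v(1) by (intro coeff_bound_product[OF \<phi> \<Phi> bound]) auto
  qed
  have "cmod (P 0) \<le> 1 + \<mu> * sqrt n * sqrt (\<Sum>k<n. \<mu> ^ (2 * k))"
  proof (rule maximum_modulus_frontier[of P K])
    show "continuous_on (closure K) P"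
      by (intro holomorphic_on_imp_continuous_on hol)
    show "0 \<in> K"
      using nz by (simp add: K_def)
  qed (use K hol frontier compact_imp_bounded in auto)
  then show ?thesis
    by (simp add: P_def)
qed

section \<open>Functions of the class and the final estimate\<close>

text \<open>Two removable singularities are filled in: f(z)/z, whose reciprocal is \<open>p\<close>,
  and (p(z) - 1)/z, which is \<open>s\<close>. Substituting z / (1 + z s) for \<open>f\<close> turns
  the defining expression into - z^2 s'(z).\<close>

lemma class_U_representation:
  assumes f: "f \<in> class_U \<mu>"
  obtains s where "s holomorphic_on unit_disk"
    "\<And>z. z \<in> unit_disk \<Longrightarrow> cmod (deriv s z) \<le> \<mu>"
    "\<And>z. z \<in> unit_disk \<Longrightarrow> 1 + z * s z \<noteq> 0"
    "\<And>z. z \<in> unit_disk \<Longrightarrow> f z = z / (1 + z * s z)"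
proof -
  have hol: "f holomorphic_on unit_disk" and f0: "f 0 = 0" and f'0: "deriv f 0 = 1"
    and fnz: "\<And>z. z \<in> unit_disk \<Longrightarrow> z \<noteq> 0 \<Longrightarrow> f z \<noteq> 0"
    and lt: "\<And>z. z \<in> unit_disk \<Longrightarrow> cmod ((id_over f z)\<^sup>2 * deriv f z - 1) < \<mu>"
    using f by (auto simp: class_U_def class_A_def analytic_imp_holomorphic)
  define p where "p = id_over f"
  define k where "k z = (if z = 0 then deriv f 0 else (f z - f 0) / (z - 0))" for z
  have k: "k holomorphic_on unit_disk"
    unfolding k_def by (rule pole_lemma_open[OF hol]) simp
  have knz: "k z \<noteq> 0" if "z \<in> unit_disk" for z
    using fnz[OF that] by (auto simp: k_def f0 f'0)
  have pk: "p = (\<lambda>z. inverse (k z))"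
    by (auto simp: p_def id_over_def k_def f0 f'0)
  have p: "p holomorphic_on unit_disk"
    unfolding pk using k knz by (intro holomorphic_intros) auto
  have pnz: "p z \<noteq> 0" if "z \<in> unit_disk" for z
    using knz[OF that] by (simp add: pk)
  define s where "s z = (if z = 0 then deriv p 0 else (p z - p 0) / (z - 0))" for z
  have s: "s holomorphic_on unit_disk"
    unfolding s_def by (rule pole_lemma_open[OF p]) simp
  have ps: "1 + z * s z = p z" for z
    by (auto simp: s_def p_def id_over_def)
  have fp: "f z = z / p z" for z
    by (auto simp: p_def id_over_def f0)
  have "cmod (z\<^sup>2 * deriv s z) \<le> \<mu>" if z: "z \<in> unit_disk" for z
  proof -
    have s': "(s has_field_derivative deriv s z) (at z)"
      by (rule holomorphic_derivI[OF s _ z]) simp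
    \<comment> \<open>In the numerator of the quotient rule the terms z s(z) cancel, leaving 1 - z^2
      s'(z).\<close>
    have "((\<lambda>z. z / (1 + z * s z)) has_field_derivative
        ((1 + z * s z) - z * (s z + z * deriv s z)) / (1 + z * s z)\<^sup>2) (at z)"
      using pnz[OF z] unfolding ps[symmetric]
      by (auto intro!: derivative_eq_intros s' simp: power2_eq_square algebra_simps)
    then have "deriv f z = (1 - z\<^sup>2 * deriv s z) / (p z)\<^sup>2"
      unfolding ps fp[symmetric] by (simp add: DERIV_imp_deriv flip: ps) (simp add: algebra_simps power2_eq_square)
    then have "(id_over f z)\<^sup>2 * deriv f z - 1 = - (z\<^sup>2 * deriv s z)"
      using pnz[OF z] by (simp add: p_def)
    then show ?thesis
      using lt[OF z] by (metis less_imp_le norm_minus_cancel)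
  qed
  then have "cmod (deriv s z) \<le> \<mu>" if "z \<in> unit_disk" for z
    using that by (intro norm_le_of_norm_square_mult_le[of "deriv s"] holomorphic_deriv s) auto
  then show ?thesis
    using that[of s] s ps pnz fp by simp
qed

theorem theorem1:
  fixes lam :: real and f :: "complex \<Rightarrow> complex" and a :: "nat \<Rightarrow> complex"
  assumes "0 < lam" and "lam \<le> 1"
    and "f \<in> class_U lam"
    and "\<forall>z \<in> unit_disk. (\<lambda>n. a (n + 2) * z ^ (n + 2)) sums (f z - z)"
  shows "\<forall>n \<ge> 2. cmod (a n) \<le> 1 + lam * sqrt (real n - 1) * sqrt (\<Sum>k = 0..n - 2. lam ^ (2 * k))"
proof (intro allI impI)
  fix n :: nat
  assume n: "2 \<le> n"
  obtain s where s: "s holomorphic_on unit_disk"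
    and s': "\<And>z. z \<in> unit_disk \<Longrightarrow> cmod (deriv s z) \<le> lam"
    and nz: "\<And>z. z \<in> unit_disk \<Longrightarrow> 1 + z * s z \<noteq> 0"
    and f: "\<And>z. z \<in> unit_disk \<Longrightarrow> f z = z / (1 + z * s z)"
    using class_U_representation[OF assms(3)] by blast
  define S where "S = fps_expansion s 0"
  have S: "s has_fps_expansion S"
    unfolding S_def by (intro has_fps_expansion_fps_expansion[of unit_disk] s) auto
  \<comment> \<open>The disk is convex, so the bound on the derivative is a Lipschitz bound.\<close>
  have lip: "cmod (s z - s w) \<le> lam * cmod (z - w)" if "z \<in> unit_disk" "w \<in> unit_disk" for z w
    using that s'
    by (intro field_differentiable_bound[of unit_disk s "deriv s"] DERIV_subset[OF holomorphic_derivI[OF s]]) auto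
  have "(\<lambda>z. z * inverse (1 + z * s z)) has_fps_expansion fps_X * inverse (1 + fps_X * S)"
    by (intro fps_expansion_intros S) simp
  moreover have ev: "\<forall>\<^sub>F z in nhds 0. z * inverse (1 + z * s z) = f z"
    by (intro eventually_nhds_in_open[of unit_disk 0, THEN eventually_mono]) (auto simp: f field_simps)
  ultimately have "f has_fps_expansion fps_X * inverse (1 + fps_X * S)"
    using has_fps_expansion_cong[OF ev refl] by blast
  \<comment> \<open>The hypothesis speaks of \<open>a m\<close> only for m >= 2; the coefficients 0
    and 1 of \<open>f\<close> are put in by hand.\<close>
  moreover define F where "F = Abs_fps (\<lambda>m. if m < 2 then of_nat m else a m)"
  have "f has_fps_expansion F"
  proof (rule has_fps_expansionI)
    have "(\<lambda>m. fps_nth F m * z ^ m) sums f z" if "z \<in> unit_disk" for z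
    proof -
      have "(\<lambda>m. fps_nth F (m + 2) * z ^ (m + 2)) sums (f z - (\<Sum>m<2. fps_nth F m * z ^ m))"
        using assms(4) that by (simp add: F_def numeral_2_eq_2)
      then show ?thesis
        by (simp only: sums_iff_shift[of "\<lambda>m. fps_nth F m * z ^ m" 2] diff_add_cancel)
    qed
    then show "\<forall>\<^sub>F z in nhds 0. (\<lambda>m. fps_nth F m * z ^ m) sums f z"
      by (intro eventually_nhds_in_open[of unit_disk 0, THEN eventually_mono]) auto
  qed
  ultimately have "F = fps_X * inverse (1 + fps_X * S)"
    using fps_expansion_eqI by metis
  then have "fps_nth F n = fps_nth (fps_X * inverse (1 + fps_X * S)) n"
    by simp
  \<comment> \<open>The factor \<open>fps_X\<close> shifts the index, whence n - 1 under the root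
    and the sum up to n - 2.\<close>
  then have "a n = fps_nth (inverse (1 + fps_X * S)) (n - 1)"
    using n by (simp add: F_def)
  moreover have "{..<n - 1} = {0..n - 2}"
    using n by auto
  ultimately show "cmod (a n) \<le> 1 + lam * sqrt (real n - 1) * sqrt (\<Sum>k = 0..n - 2. lam ^ (2 * k))"
    using coeff_bound_lipschitz[OF s S lip nz, of "n - 1"] n by (simp add: of_nat_diff)
qed

end
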